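(* Let $d\ge2$ be an integer and define $$A_tf(y)=\int_0^1f(y_1-tx,\;y_2-t^dx^d)\,dx .$$ Then for every $(\frac1p,\frac1q)\in\Delta_3=\{(\frac1p,\frac1q):\frac1{2p}<\frac1q\le\frac1p,\ \frac1q>\frac2p-1,\ \frac1q>\frac1p-\frac1{d+1}\}\cup\{(0,0),(1,1)\}$ there exists a constant $C_{p,q}>0$ such that $\big\|\sup_{t\in[1,2]}|A_t|\big\|_{L^p\to L^q}\le C_{p,q}$.
   Context: Here $y=(y_1,y_2)\in\mathbb{R}^2$. $\big\|\sup_{t\in[1,2]}|A_t|\big\|_{L^p\to L^q}\le C$ means $\big\|\sup_{t\in[1,2]}|A_tf|\big\|_{L^q(\mathbb{R}^2)}\le C\|f\|_{L^p(\mathbb{R}^2)}$ for all $f\in C_0^\infty(\mathbb{R}^2)$. The point $(0,0)$ corresponds to $p=q=\infty$. *)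

theory Defs
  imports "HOL-Analysis.Analysis" "HOL-Probability.Essential_Supremum"
begin

primrec C_k :: "nat \<Rightarrow> ('a::euclidean_space \<Rightarrow> 'b::real_normed_vector) \<Rightarrow> bool" where
  "C_k 0 f \<longleftrightarrow> continuous_on UNIV f"
| "C_k (Suc k) f \<longleftrightarrow>
     (\<forall>x. f differentiable (at x)) \<and> (\<forall>v. C_k k (\<lambda>x. frechet_derivative f (at x) v))"

definition test_function :: "('a::euclidean_space \<Rightarrow> 'b::real_normed_vector) \<Rightarrow> bool" where
  "test_function f \<longleftrightarrow> (\<forall>k. C_k k f) \<and> compact (closure {x. f x \<noteq> 0})"

text \<open>Real power with a positive exponent on \<open>[0,\<infinity>]\<close>.\<close>

definition ennpowr :: "ennreal \<Rightarrow> real \<Rightarrow> ennreal" where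
  "ennpowr x a = (if x = \<infinity> then \<infinity> else ennreal (enn2real x powr a))"

text \<open>
  The \<open>L\<^sup>p\<close> norm of a \<open>[0,\<infinity>]\<close>-valued function; functions with values
  in a normed space enter through their pointwise norm. Intended for \<open>p \<ge> 1\<close>.
\<close>

definition Lp_norm :: "ennreal \<Rightarrow> ('a::euclidean_space \<Rightarrow> ennreal) \<Rightarrow> ennreal" where
  "Lp_norm p g =
     (if p = \<infinity> then esssup lborel g
      else ennpowr (\<integral>\<^sup>+ y. ennpowr (g y) (enn2real p) \<partial>lborel) (1 / enn2real p))"

definition avg :: "nat \<Rightarrow> real \<Rightarrow> (real \<times> real \<Rightarrow> complex) \<Rightarrow> real \<times> real \<Rightarrow> complex" where
  "avg d t f = (\<lambda>(y1, y2). LINT x:{0..1}|lborel. f (y1 - t * x, y2 - t ^ d * x ^ d))"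

definition maximal_avg :: "nat \<Rightarrow> (real \<times> real \<Rightarrow> complex) \<Rightarrow> real \<times> real \<Rightarrow> ennreal" where
  "maximal_avg d f y = (SUP t\<in>{1..2}. ennreal (norm (avg d t f y)))"

definition maximal_bound :: "nat \<Rightarrow> ennreal \<Rightarrow> ennreal \<Rightarrow> real \<Rightarrow> bool" where
  "maximal_bound d p q C \<longleftrightarrow>
     (\<forall>f. test_function f \<longrightarrow>
        Lp_norm q (maximal_avg d f) \<le> ennreal C * Lp_norm p (\<lambda>y. ennreal (norm (f y))))"

text \<open>The pairs \<open>(a, b)\<close> stand for \<open>(1/p, 1/q)\<close>.\<close>

definition Delta3 :: "nat \<Rightarrow> (real \<times> real) set" where
  "Delta3 d =
     {(a, b). a / 2 < b \<and> b \<le> a \<and> b > 2 * a - 1 \<and> b > a - 1 / (real d + 1)}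
     \<union> {(0, 0), (1, 1)}"

end

theory Submission
  imports Defs
begin

text \<open>
  Since \<open>t\<^sup>d x\<^sup>d = (t x)\<^sup>d\<close>, the dilates stay on one curve \<open>\<gamma>(u) = (u, u\<^sup>d)\<close>, so the
  maximal function is dominated by the single average
  \<open>T f(y) = \<integral>\<^bsub>[0,2]\<^esub> |f|(y - \<gamma>(u)) du\<close>, and an \<open>L\<^sup>p\<close>-improving bound for \<open>T\<close> suffices.
  For \<open>q = p\<close> it is Hoelder's inequality.
  For \<open>q > p\<close> put \<open>h = |f|\<^sup>p\<close> and \<open>\<eta> = (1/p - 1/q) / (1 - 1/q)\<close>. Hoelder gives
  \<open>(T f)\<^sup>q \<le> T h (T h\<^sup>\<eta>)\<^bsup>q-1\<^esup>\<close> pointwise, and a translation turns the integral of the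
  right-hand side into \<open>\<integral> h(z) \<integral> (\<integral> h\<^sup>\<eta>(z + \<gamma>(s) - \<gamma>(u)) du)\<^bsup>q-1\<^esup> ds dz\<close>. The map
  \<open>(s, u) \<mapsto> \<gamma>(s) - \<gamma>(u)\<close> has Jacobian at least \<open>J = |s - u| max(s, u)\<^bsup>d-2\<^esup>\<close>; splitting
  \<open>h\<^sup>\<eta> = (h J)\<^sup>\<eta> J\<^bsup>-\<eta>\<^esup>\<close> and applying Hoelder in \<open>u\<close> and then in \<open>s\<close> leaves powers of \<open>J\<close>.
  In \<open>u\<close> they are integrable because \<open>\<eta> < 1/2\<close>, that is \<open>1/q > 2/p - 1\<close>. Hoelder in \<open>s\<close> needs
  \<open>\<eta>(q - 1) < 1\<close>, that is \<open>1/q > 1/(2p)\<close>, and the remaining singularity at \<open>s = 0\<close> is integrable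
  because \<open>1/p - 1/q < 1/(d + 1)\<close>.
\<close>

section \<open>Powers and Hoelder's inequality for extended nonnegative reals\<close>

lemma ennpowr_ennreal: "x \<ge> 0 \<Longrightarrow> ennpowr (ennreal x) a = ennreal (x powr a)"
  by (simp add: ennpowr_def)

lemma ennpowr_top [simp]: "ennpowr \<infinity> a = \<infinity>" "ennpowr top a = top"
  by (simp_all add: ennpowr_def)

lemma ennpowr_zero [simp]: "ennpowr 0 a = 0"
  by (simp add: ennpowr_def)

lemma ennpowr_1 [simp]: "ennpowr x 1 = x"
  by (cases x) (simp_all add: ennpowr_ennreal)

lemma ennpowr_eq_0_iff [simp]: "ennpowr x a = 0 \<longleftrightarrow> x = 0"
  by (cases x) (auto simp: ennpowr_ennreal ennreal_eq_0_iff)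

lemma ennpowr_mono: "a \<ge> 0 \<Longrightarrow> x \<le> y \<Longrightarrow> ennpowr x a \<le> ennpowr y a"
  by (cases x; cases y) (auto simp: ennpowr_ennreal top_unique intro!: ennreal_leI powr_mono2)

lemma ennpowr_mult: "ennpowr (x * y) a = ennpowr x a * ennpowr y a"
proof (cases "x = 0 \<or> y = 0 \<or> x = top \<or> y = top")
  case True
  then show ?thesis by (auto simp: ennreal_mult_eq_top_iff ennreal_mult_top ennreal_top_mult)
next
  case False
  then show ?thesis
    by (cases x; cases y) (auto simp: ennpowr_ennreal powr_mult simp flip: ennreal_mult)
qed

lemma ennpowr_ennpowr: "ennpowr (ennpowr x a) b = ennpowr x (a * b)"
  by (cases x) (auto simp: ennpowr_ennreal powr_powr)

lemma ennpowr_add: "ennpowr x (a + b) = ennpowr x a * ennpowr x b"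
  by (cases x) (auto simp: ennpowr_ennreal powr_add ennreal_mult ennreal_mult_top)

lemma borel_measurable_ennpowr [measurable (raw)]:
  assumes [measurable]: "f \<in> borel_measurable M"
  shows "(\<lambda>x. ennpowr (f x) a) \<in> borel_measurable M"
  unfolding ennpowr_def by measurable

text \<open>Weighted AM-GM, from convexity of \<open>exp\<close> at \<open>ln a\<close> and
  \<open>ln b\<close>. Both weights are positive, so an infinite argument makes the right-hand side
  infinite.\<close>

lemma ennpowr_young:
  assumes "0 < t" "t < 1"
  shows "ennpowr x t * ennpowr y (1 - t) \<le> ennreal t * x + ennreal (1 - t) * y"
proof (cases "x = top \<or> y = top")
  case True
  then have "ennreal t * x + ennreal (1 - t) * y = top"
    using assms by (auto simp: ennreal_mult_eq_top_iff)
  then show ?thesis by (simp only: top_greatest)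
next
  case False
  then obtain a b where ab: "x = ennreal a" "y = ennreal b" "a \<ge> 0" "b \<ge> 0"
    by (cases x; cases y) auto
  have "a powr t * b powr (1 - t) \<le> t * a + (1 - t) * b"
  proof (cases "a = 0 \<or> b = 0")
    case True then show ?thesis using assms ab by auto
  next
    case False
    then have pos: "a > 0" "b > 0" using ab by auto
    have "exp ((1 - t) *\<^sub>R ln b + t *\<^sub>R ln a) \<le> (1 - t) * exp (ln b) + t * exp (ln a)"
      using assms by (intro convex_onD[OF exp_convex]) auto
    then show ?thesis using pos by (simp add: powr_def algebra_simps flip: exp_add)
  qed
  then have "ennreal (a powr t * b powr (1 - t)) \<le> ennreal (t * a + (1 - t) * b)"
    by (rule ennreal_leI)
  then show ?thesis
    using ab assms by (simp add: ennpowr_ennreal ennreal_mult)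
qed

text \<open>Normalise both integrals to 1 and integrate \<open>ennpowr_young\<close> pointwise. A
  vanishing integral is treated before an infinite one because \<open>0 * top = 0\<close>.\<close>

lemma nn_integral_Holder:
  assumes [measurable]: "F \<in> borel_measurable M" "G \<in> borel_measurable M"
    and t: "0 < t" "t < 1"
  shows "(\<integral>\<^sup>+x. ennpowr (F x) t * ennpowr (G x) (1 - t) \<partial>M)
      \<le> ennpowr (\<integral>\<^sup>+x. F x \<partial>M) t * ennpowr (\<integral>\<^sup>+x. G x \<partial>M) (1 - t)"
    (is "_ \<le> ennpowr ?A t * ennpowr ?B (1 - t)")
proof (cases "?A = 0 \<or> ?B = 0")
  case True
  then have "AE x in M. F x = 0 \<or> G x = 0"
    by (auto simp: nn_integral_0_iff_AE elim: eventually_mono)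
  then have "AE x in M. ennpowr (F x) t * ennpowr (G x) (1 - t) = 0"
    by eventually_elim auto
  then have "(\<integral>\<^sup>+x. ennpowr (F x) t * ennpowr (G x) (1 - t) \<partial>M) = 0"
    by (subst nn_integral_0_iff_AE) auto
  then show ?thesis by simp
next
  case nz: False
  show ?thesis
  proof (cases "?A = top \<or> ?B = top")
    case True
    then have "ennpowr ?A t * ennpowr ?B (1 - t) = top"
      using nz by (auto simp: ennreal_mult_eq_top_iff)
    then show ?thesis by simp
  next
    case False
    let ?K = "ennpowr ?A t * ennpowr ?B (1 - t)"
    have "ennpowr (F x) t * ennpowr (G x) (1 - t)
        \<le> ?K * (ennreal t * (F x / ?A) + ennreal (1 - t) * (G x / ?B))" for x
    proof -
      have "F x = ?A * (F x / ?A)" "G x = ?B * (G x / ?B)"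
        using nz False by (auto simp: ennreal_times_divide mult_divide_eq_ennreal top.not_eq_extremum mult.commute)
      then have "ennpowr (F x) t * ennpowr (G x) (1 - t)
          = ?K * (ennpowr (F x / ?A) t * ennpowr (G x / ?B) (1 - t))"
        by (metis (no_types, lifting) ennpowr_mult mult.assoc mult.left_commute)
      then show ?thesis using ennpowr_young[OF t] by (auto intro: mult_left_mono)
    qed
    then have "(\<integral>\<^sup>+x. ennpowr (F x) t * ennpowr (G x) (1 - t) \<partial>M)
        \<le> (\<integral>\<^sup>+x. ?K * (ennreal t * (F x / ?A) + ennreal (1 - t) * (G x / ?B)) \<partial>M)"
      by (intro nn_integral_mono)
    also have "\<dots> = ?K * (ennreal t * (?A / ?A) + ennreal (1 - t) * (?B / ?B))"
      by (simp add: nn_integral_cmult nn_integral_add nn_integral_divide)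
    also have "?A / ?A = 1" using nz False by (intro ennreal_divide_self) (auto simp: top.not_eq_extremum)
    also have "?B / ?B = 1" using nz False by (intro ennreal_divide_self) (auto simp: top.not_eq_extremum)
    also have "ennreal t * 1 + ennreal (1 - t) * 1 = 1"
      using t by (simp flip: ennreal_plus)
    finally show ?thesis by simp
  qed
qed

text \<open>Prepares Hoelder's inequality with a weight: the exponent \<open>- (t / (1 - t))\<close>
  becomes \<open>- t\<close> after raising to \<open>1 - t\<close>, so the inserted powers of
  \<open>w\<close> cancel.\<close>

lemma ennreal_mult_powr_split:
  assumes "w > 0" "0 < t" "t < 1"
  shows "ennpowr x t = ennpowr (x * ennreal w) t * ennpowr (ennreal (w powr - (t / (1 - t)))) (1 - t)"
proof -
  have "ennpowr (ennreal w) t * ennpowr (ennreal (w powr - (t / (1 - t)))) (1 - t)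
      = ennreal (w powr t * (w powr - (t / (1 - t))) powr (1 - t))"
    using assms by (simp add: ennpowr_ennreal ennreal_mult)
  also have "w powr t * (w powr - (t / (1 - t))) powr (1 - t) = 1"
    using assms by (simp add: powr_powr flip: powr_add)
  finally have "ennpowr (ennreal w) t * ennpowr (ennreal (w powr - (t / (1 - t)))) (1 - t) = 1"
    by simp
  then show ?thesis by (simp add: ennpowr_mult mult.assoc)
qed

section \<open>Integrals of powers in one variable\<close>

lemma nn_integral_powr_0_2:
  assumes "a > -1"
  shows "(\<integral>\<^sup>+u. ennreal (u powr a) * indicator {0..2} u \<partial>lborel) = ennreal (2 powr (a + 1) / (a + 1))"
  using has_integral_powr_from_0[OF assms, of 2] 
  by (intro nn_integral_has_integral_lebesgue') auto

lemma nn_integral_abs_powr_translate_le: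
  assumes "\<sigma> < 1"
  shows "(\<integral>\<^sup>+u. ennreal (\<bar>s - u\<bar> powr - \<sigma>) * indicator {s-2..s+2} u \<partial>lborel)
      \<le> ennreal (2 * (2 powr (1 - \<sigma>) / (1 - \<sigma>)))"
proof -
  let ?f = "\<lambda>u. ennreal (\<bar>s - u\<bar> powr - \<sigma>) * indicator {s-2..s+2} u"
  let ?g = "\<lambda>v::real. ennreal (v powr - \<sigma>) * indicator {0..2} v"
  have "integral\<^sup>N lborel ?f = (\<integral>\<^sup>+v. ?f (s + v) \<partial>lborel)"
    by (subst nn_integral_real_affine[where c = 1 and t = s]) auto
  also have "\<dots> \<le> (\<integral>\<^sup>+v. ?g v + ?g (- v) \<partial>lborel)"
    by (intro nn_integral_mono) (auto split: split_indicator)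
  also have "\<dots> = integral\<^sup>N lborel ?g + (\<integral>\<^sup>+v. ?g (- v) \<partial>lborel)"
    by (intro nn_integral_add) auto
  also have "(\<integral>\<^sup>+v. ?g (- v) \<partial>lborel) = integral\<^sup>N lborel ?g"
    by (subst (2) nn_integral_real_affine[where c = "-1" and t = 0]) auto
  also have "integral\<^sup>N lborel ?g = ennreal (2 powr (1 - \<sigma>) / (1 - \<sigma>))"
    using nn_integral_powr_0_2[of "- \<sigma>"] assms by simp
  also have "\<dots> + \<dots> = ennreal (2 * (2 powr (1 - \<sigma>) / (1 - \<sigma>)))"
    using assms by (subst ennreal_plus[symmetric]) auto
  finally show ?thesis by simp
qed

section \<open>Differences of points on the curve\<close>

text \<open>A lower bound for the Jacobian \<open>d |s\<^bsup>d-1\<^esup> - u\<^bsup>d-1\<^esup>|\<close> of \<open>(s, u) \<mapsto> (s - u, s\<^sup>d - u\<^sup>d)\<close>.\<close>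

definition gap_weight :: "nat \<Rightarrow> real \<Rightarrow> real \<Rightarrow> real" where
  "gap_weight d s u = \<bar>s - u\<bar> * max s u ^ (d - 2)"

lemma gap_weight_commute: "gap_weight d s u = gap_weight d u s"
  by (simp add: gap_weight_def abs_minus_commute max.commute)

lemma borel_measurable_gap_weight [measurable (raw)]:
  assumes [measurable]: "f \<in> borel_measurable M" "g \<in> borel_measurable M"
  shows "(\<lambda>x. gap_weight d (f x) (g x)) \<in> borel_measurable M"
  unfolding gap_weight_def by measurable

text \<open>Since \<open>u \<le> s\<close>, \<open>u ^ (d - 1) \<le> u * s ^ (d - 2)\<close>, which
  leaves a factor \<open>s - u\<close>. The product form is what later allows negative powers to be
  split between the factors.\<close>

lemma gap_weight_le:
  assumes "2 \<le> d" "0 \<le> u" "u \<le> s"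
  shows "gap_weight d s u \<le> real d * (s ^ (d - 1) - u ^ (d - 1))"
proof -
  obtain n where d: "d = Suc (Suc n)"
    using assms(1) by (metis add_2_eq_Suc le_Suc_ex)
  have "u ^ Suc n \<le> u * s ^ n"
    using assms by (auto intro!: mult_left_mono power_mono)
  then have "(s - u) * s ^ n \<le> s ^ Suc n - u ^ Suc n"
    by (simp add: algebra_simps)
  also have "\<dots> \<le> real d * (s ^ Suc n - u ^ Suc n)"
    using mult_right_mono[of 1 "real d" "s ^ Suc n - u ^ Suc n"] power_mono[of u s "Suc n"] assms
    by simp
  finally show ?thesis using assms d by (simp add: gap_weight_def)
qed

text \<open>Putting \<open>r = s - u\<close> and exchanging the integrals reduces the planar change
  of variables to the substitution \<open>w = s ^ d - (s - r) ^ d\<close> for each fixed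
  \<open>r\<close>. On the half \<open>u \<le> s\<close> it is nondecreasing in \<open>s\<close>,
  and \<open>gap_weight_le\<close> bounds its derivative from below.\<close>

lemma nn_integral_curve_diff_half:
  fixes h :: "real \<times> real \<Rightarrow> real"
  assumes [measurable]: "h \<in> borel_measurable borel" and nn: "\<And>x. 0 \<le> h x" and d: "2 \<le> d"
  shows "(\<integral>\<^sup>+s. (\<integral>\<^sup>+u. ennreal (h (s - u, s ^ d - u ^ d)) * ennreal (gap_weight d s u)
            * indicator {0..s} u * indicator {0..2} s \<partial>lborel) \<partial>lborel)
      \<le> (\<integral>\<^sup>+x. ennreal (h x) \<partial>lborel)"
proof -
  have "(\<integral>\<^sup>+u. ennreal (h (s - u, s ^ d - u ^ d)) * ennreal (gap_weight d s u)
            * indicator {0..s} u * indicator {0..2} s \<partial>lborel)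
      = (\<integral>\<^sup>+r. ennreal (h (r, s ^ d - (s - r) ^ d)) * ennreal (gap_weight d s (s - r))
            * indicator {0..s} r * indicator {0..2} s \<partial>lborel)" for s :: real
    by (subst nn_integral_real_affine[where c = "-1" and t = s])
       (auto intro!: nn_integral_cong split: split_indicator)
  then have "(\<integral>\<^sup>+s. (\<integral>\<^sup>+u. ennreal (h (s - u, s ^ d - u ^ d)) * ennreal (gap_weight d s u)
            * indicator {0..s} u * indicator {0..2} s \<partial>lborel) \<partial>lborel)
      = (\<integral>\<^sup>+s. (\<integral>\<^sup>+r. ennreal (h (r, s ^ d - (s - r) ^ d)) * ennreal (gap_weight d s (s - r))
            * indicator {0..s} r * indicator {0..2} s \<partial>lborel) \<partial>lborel)"
    by simp
  also have "\<dots> = (\<integral>\<^sup>+r. (\<integral>\<^sup>+s. ennreal (h (r, s ^ d - (s - r) ^ d)) * ennreal (gap_weight d s (s - r))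
            * indicator {0..s} r * indicator {0..2} s \<partial>lborel) \<partial>lborel)"
    unfolding indicator_def atLeastAtMost_iff
    by (rule lborel_pair.Fubini') measurable
  also have "\<dots> \<le> (\<integral>\<^sup>+r. (\<integral>\<^sup>+w. ennreal (h (r, w)) \<partial>lborel) \<partial>lborel)"
  proof (rule nn_integral_mono)
    fix r :: real
    show "(\<integral>\<^sup>+s. ennreal (h (r, s ^ d - (s - r) ^ d)) * ennreal (gap_weight d s (s - r))
            * indicator {0..s} r * indicator {0..2} s \<partial>lborel) \<le> (\<integral>\<^sup>+w. ennreal (h (r, w)) \<partial>lborel)"
    \<comment> \<open>The indicators force \<open>0 \<le> r \<le> s \<le> 2\<close>.\<close>
    proof (cases "0 \<le> r \<and> r \<le> 2")
      case False
      then have "(\<integral>\<^sup>+s. ennreal (h (r, s ^ d - (s - r) ^ d)) * ennreal (gap_weight d s (s - r))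
            * indicator {0..s} r * indicator {0..2} s \<partial>lborel) = (\<integral>\<^sup>+s. 0 \<partial>(lborel :: real measure))"
        by (intro nn_integral_cong) (auto split: split_indicator)
      then show ?thesis by simp
    next
      case r: True
      let ?g = "\<lambda>s. s ^ d - (s - r) ^ d"
      let ?g' = "\<lambda>s. real d * (s ^ (d - 1) - (s - r) ^ (d - 1))"
      have "(\<integral>\<^sup>+s. ennreal (h (r, ?g s)) * ennreal (gap_weight d s (s - r))
            * indicator {0..s} r * indicator {0..2} s \<partial>lborel)
          \<le> (\<integral>\<^sup>+s. ennreal (h (r, ?g s) * ?g' s * indicator {r..2} s) \<partial>lborel)"
      proof (rule nn_integral_mono)
        fix s :: real
        have "gap_weight d s (s - r) \<le> ?g' s" if "r \<le> s"
          using gap_weight_le[OF d, of "s - r" s] that r by simp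
        then have "h (r, ?g s) * gap_weight d s (s - r) \<le> h (r, ?g s) * ?g' s" if "r \<le> s"
          using nn that by (intro mult_left_mono) auto
        then show "ennreal (h (r, ?g s)) * ennreal (gap_weight d s (s - r))
            * indicator {0..s} r * indicator {0..2} s
            \<le> ennreal (h (r, ?g s) * ?g' s * indicator {r..2} s)"
          using r nn by (auto split: split_indicator simp flip: ennreal_mult' intro!: ennreal_leI)
      qed
      also have "\<dots> = (\<integral>\<^sup>+w. ennreal (h (r, w) * indicator {?g r..?g 2} w) \<partial>lborel)"
      proof (rule nn_integral_substitution[symmetric])
        show "set_borel_measurable borel {?g r..?g 2} (\<lambda>w. h (r, w))"
          unfolding set_borel_measurable_def by measurable
        show "(?g has_real_derivative ?g' x) (at x)" for x
          by (auto intro!: derivative_eq_intros simp: algebra_simps)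
        show "continuous_on {r..2} ?g'" by (intro continuous_intros)
        show "?g' x \<ge> 0" if "x \<in> {r..2}" for x
          using that r by (auto intro!: mult_nonneg_nonneg power_mono)
        show "r \<le> 2" using r by simp
      qed
      also have "\<dots> \<le> (\<integral>\<^sup>+w. ennreal (h (r, w)) \<partial>lborel)"
        using nn by (intro nn_integral_mono) (auto split: split_indicator)
      finally show ?thesis .
    qed
  qed
  also have "\<dots> = (\<integral>\<^sup>+x. ennreal (h x) \<partial>(lborel \<Otimes>\<^sub>M lborel))"
    by (rule lborel.nn_integral_fst) (simp add: lborel_prod)
  also have "\<dots> = (\<integral>\<^sup>+x. ennreal (h x) \<partial>lborel)"
    by (simp add: lborel_prod)
  finally show ?thesis .
qed

section \<open>Invariance of Lebesgue measure and the parameter measure\<close>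

lemma nn_integral_uminus:
  fixes h :: "'a::euclidean_space \<Rightarrow> ennreal"
  assumes [measurable]: "h \<in> borel_measurable borel"
  shows "(\<integral>\<^sup>+x. h (- x) \<partial>lborel) = (\<integral>\<^sup>+x. h x \<partial>lborel)"
proof -
  have "distr lborel borel uminus = (lborel :: 'a measure)"
    by (subst lborel_affine[of "-1" 0]) (auto simp: density_1)
  then show ?thesis
    using nn_integral_distr[of uminus lborel "borel :: 'a measure" h] by simp
qed

lemma nn_integral_translate:
  fixes h :: "'a::euclidean_space \<Rightarrow> ennreal"
  assumes [measurable]: "h \<in> borel_measurable borel"
  shows "(\<integral>\<^sup>+x. h (c + x) \<partial>lborel) = (\<integral>\<^sup>+x. h x \<partial>lborel)"
  using nn_integral_distr[of "(+) c" lborel "borel :: 'a measure" h] by (simp add: lborel_distr_plus)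

text \<open>The parameter \<open>t * x\<close> with \<open>t\<close> in [1,2] and \<open>x\<close>
  in [0,1] ranges over [0,2]. A measure in place of an indicator lets Hoelder and Fubini apply to it
  directly.\<close>

abbreviation param :: "real measure" where
  "param \<equiv> density lborel (indicator {0..2})"

lemma nn_integral_param:
  "F \<in> borel_measurable borel \<Longrightarrow> (\<integral>\<^sup>+u. F u \<partial>param) = (\<integral>\<^sup>+u. F u * indicator {0..2} u \<partial>lborel)"
  by (subst nn_integral_density) (auto simp: mult.commute)

lemma AE_param: "(AE u in param. P u) \<longleftrightarrow> (AE u in lborel. u \<in> {0..2} \<longrightarrow> P u)"
  by (subst AE_density) (auto simp: indicator_def)

lemma finite_measure_param: "finite_measure param"
  by (intro finite_measureI) (simp add: emeasure_density)

interpretation param: finite_measure param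
  by (rule finite_measure_param)

interpretation lborel_param: pair_sigma_finite "lborel :: (real \<times> real) measure" param ..

text \<open>Exchanging \<open>s\<close> and \<open>u\<close> carries the half
  \<open>s \<le> u\<close> to the half already treated and changes the sign of the difference, so
  \<open>h\<close> is reflected there. Each half contributes one integral of \<open>h\<close>, hence
  the factor 2.\<close>

lemma nn_integral_curve_diff:
  fixes h :: "real \<times> real \<Rightarrow> real"
  assumes [measurable]: "h \<in> borel_measurable borel" and nn: "\<And>x. 0 \<le> h x" and d: "2 \<le> d"
  shows "(\<integral>\<^sup>+s. (\<integral>\<^sup>+u. ennreal (h (s - u, s ^ d - u ^ d)) * ennreal (gap_weight d s u)
            \<partial>param) \<partial>param) \<le> 2 * (\<integral>\<^sup>+x. ennreal (h x) \<partial>lborel)"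
proof -
  let ?F = "\<lambda>h s u. ennreal (h (s - u, s ^ d - u ^ d)) * ennreal (gap_weight d s u)
            * indicator {0..s} u * indicator {0..2} s"
  let ?h' = "\<lambda>x. h (- x)"
  have 1: "(\<lambda>s. \<integral>\<^sup>+u. ?F h s u \<partial>lborel) \<in> borel_measurable borel"
     "(\<lambda>s. \<integral>\<^sup>+u. ?F ?h' u s \<partial>lborel) \<in> borel_measurable borel"
     unfolding indicator_def atLeastAtMost_iff by measurable
  have "(\<integral>\<^sup>+s. (\<integral>\<^sup>+u. ennreal (h (s - u, s ^ d - u ^ d)) * ennreal (gap_weight d s u)
            \<partial>param) \<partial>param)
      = (\<integral>\<^sup>+s. (\<integral>\<^sup>+u. ennreal (h (s - u, s ^ d - u ^ d)) * ennreal (gap_weight d s u)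
            * indicator {0..2} u * indicator {0..2} s \<partial>lborel) \<partial>lborel)"
    by (subst nn_integral_param, measurable) (subst nn_integral_param, measurable, subst nn_integral_multc, measurable)
  also have "\<dots> \<le> (\<integral>\<^sup>+s. (\<integral>\<^sup>+u. ?F h s u + ?F ?h' u s \<partial>lborel) \<partial>lborel)"
    by (intro nn_integral_mono) (auto split: split_indicator simp: gap_weight_commute)
  also have "\<dots> = (\<integral>\<^sup>+s. (\<integral>\<^sup>+u. ?F h s u \<partial>lborel) + (\<integral>\<^sup>+u. ?F ?h' u s \<partial>lborel) \<partial>lborel)"
    by (intro nn_integral_cong nn_integral_add) (auto simp: indicator_def)
  also have "\<dots> = (\<integral>\<^sup>+s. (\<integral>\<^sup>+u. ?F h s u \<partial>lborel) \<partial>lborel) + (\<integral>\<^sup>+s. (\<integral>\<^sup>+u. ?F ?h' u s \<partial>lborel) \<partial>lborel)"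
    using 1 by (intro nn_integral_add) auto
  also have "(\<integral>\<^sup>+s. (\<integral>\<^sup>+u. ?F ?h' u s \<partial>lborel) \<partial>lborel) = (\<integral>\<^sup>+u. (\<integral>\<^sup>+s. ?F ?h' u s \<partial>lborel) \<partial>lborel)"
    unfolding indicator_def atLeastAtMost_iff
    by (rule lborel_pair.Fubini') measurable
  also have "\<dots> \<le> (\<integral>\<^sup>+x. ennreal (?h' x) \<partial>lborel)"
    by (rule nn_integral_curve_diff_half) (use nn d in auto)
  also have "\<dots> = (\<integral>\<^sup>+x. ennreal (h x) \<partial>lborel)"
    by (rule nn_integral_uminus[of "\<lambda>x. ennreal (h x)"]) measurable
  also have "(\<integral>\<^sup>+s. (\<integral>\<^sup>+u. ?F h s u \<partial>lborel) \<partial>lborel) \<le> (\<integral>\<^sup>+x. ennreal (h x) \<partial>lborel)"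
    by (rule nn_integral_curve_diff_half) (use nn d in auto)
  finally show ?thesis by (simp add: mult_2 add_mono)
qed

text \<open>\<open>max s u\<close> dominates both \<open>s\<close> and
  \<open>\<bar>s - u\<bar>\<close>. Of its exponent \<open>(d - 2) * \<kappa>\<close> the part
  \<open>m\<close> is charged to \<open>s\<close> and the rest to \<open>\<bar>s - u\<bar>\<close>,
  whose total exponent is then \<open>\<sigma>\<close>; \<open>\<sigma> < 1\<close> makes it
  integrable.\<close>

lemma nn_integral_gap_weight_powr_le:
  assumes d: "2 \<le> d" and s: "0 < s" "s \<le> 2" and m: "0 \<le> m" "m \<le> (real d - 2) * \<kappa>"
    and \<sigma>: "\<sigma> = (real d - 1) * \<kappa> - m" "\<sigma> < 1"
  shows "(\<integral>\<^sup>+u. ennreal (gap_weight d s u powr - \<kappa>) \<partial>param)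
      \<le> ennreal (2 * (2 powr (1 - \<sigma>) / (1 - \<sigma>)) * s powr - m)"
proof -
  have pt: "gap_weight d s u powr - \<kappa> \<le> s powr - m * \<bar>s - u\<bar> powr - \<sigma>" if "0 \<le> u" for u
  \<comment> \<open>On the diagonal both sides are 0, because \<open>0 powr x = 0\<close> for every
    \<open>x\<close>.\<close>
  proof (cases "u = s")
    case True
    then show ?thesis by (simp add: gap_weight_def)
  next
    case False
    define M where "M = max s u"
    define k where "k = (real d - 2) * \<kappa> - m"
    have M: "0 < M" "s \<le> M" "\<bar>s - u\<bar> \<le> M" and k: "k \<ge> 0"
      using s that m by (auto simp: M_def k_def)
    have "gap_weight d s u powr - \<kappa> = \<bar>s - u\<bar> powr - \<kappa> * (M powr - m * M powr - k)"
    proof -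
      have "M ^ (d - 2) = M powr (real d - 2)"
        using M d by (simp add: of_nat_diff flip: powr_realpow)
      then have "gap_weight d s u powr - \<kappa> = \<bar>s - u\<bar> powr - \<kappa> * M powr ((real d - 2) * - \<kappa>)"
        by (simp add: gap_weight_def powr_mult powr_powr flip: M_def)
      also have "(real d - 2) * - \<kappa> = - m + - k" by (simp add: k_def)
      finally show ?thesis by (simp only: powr_add)
    qed
    also have "\<dots> \<le> \<bar>s - u\<bar> powr - \<kappa> * (s powr - m * \<bar>s - u\<bar> powr - k)"
      using M False s k m by (intro mult_left_mono mult_mono powr_mono2') auto
    also have "\<dots> = s powr - m * \<bar>s - u\<bar> powr - \<sigma>"
      using False by (simp add: \<sigma> k_def algebra_simps flip: powr_add)
    finally show ?thesis .
  qed
  have "(\<integral>\<^sup>+u. ennreal (gap_weight d s u powr - \<kappa>) \<partial>param)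
      \<le> (\<integral>\<^sup>+u. ennreal (s powr - m) * (ennreal (\<bar>s - u\<bar> powr - \<sigma>) * indicator {s-2..s+2} u) \<partial>lborel)"
    by (subst nn_integral_param, measurable, intro nn_integral_mono)
      (use s pt in \<open>auto split: split_indicator simp flip: ennreal_mult intro!: ennreal_leI\<close>)
  also have "\<dots> = ennreal (s powr - m) * (\<integral>\<^sup>+u. ennreal (\<bar>s - u\<bar> powr - \<sigma>) * indicator {s-2..s+2} u \<partial>lborel)"
    by (intro nn_integral_cmult) auto
  also have "\<dots> \<le> ennreal (s powr - m) * ennreal (2 * (2 powr (1 - \<sigma>) / (1 - \<sigma>)))"
    by (intro mult_left_mono nn_integral_abs_powr_translate_le \<sigma>) auto
  also have "\<dots> = ennreal (2 * (2 powr (1 - \<sigma>) / (1 - \<sigma>)) * s powr - m)"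
    using \<sigma> by (subst ennreal_mult[symmetric]) (auto simp: mult.commute)
  finally show ?thesis .
qed

section \<open>Bounds for the average along the curve\<close>

definition curve :: "nat \<Rightarrow> real \<Rightarrow> real \<times> real" where
  "curve d u = (u, u ^ d)"

definition curve_avg :: "nat \<Rightarrow> (real \<times> real \<Rightarrow> ennreal) \<Rightarrow> real \<times> real \<Rightarrow> ennreal" where
  "curve_avg d F y = (\<integral>\<^sup>+u. F (y - curve d u) \<partial>param)"

lemma borel_measurable_curve [measurable (raw)]:
  assumes [measurable]: "f \<in> borel_measurable M"
  shows "(\<lambda>x. curve d (f x)) \<in> borel_measurable M"
  unfolding curve_def by measurable

lemma borel_measurable_curve_avg [measurable (raw)]:
  assumes [measurable]: "F \<in> borel_measurable borel" "f \<in> borel_measurable M"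
  shows "(\<lambda>x. curve_avg d F (f x)) \<in> borel_measurable M"
  unfolding curve_avg_def by measurable

text \<open>Passage to the adjoint average: Fubini and the translation
  \<open>y = z + curve d s\<close>.\<close>

lemma nn_integral_curve_avg_mult:
  assumes [measurable]: "F \<in> borel_measurable borel" "\<Phi> \<in> borel_measurable borel"
  shows "(\<integral>\<^sup>+y. curve_avg d F y * \<Phi> y \<partial>lborel)
      = (\<integral>\<^sup>+z. F z * (\<integral>\<^sup>+s. \<Phi> (z + curve d s) \<partial>param) \<partial>lborel)"
proof -
  have "(\<integral>\<^sup>+y. curve_avg d F y * \<Phi> y \<partial>lborel)
      = (\<integral>\<^sup>+y. (\<integral>\<^sup>+s. F (y - curve d s) * \<Phi> y \<partial>param) \<partial>lborel)"
    unfolding curve_avg_def by (subst nn_integral_multc) measurable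
  also have "\<dots> = (\<integral>\<^sup>+s. (\<integral>\<^sup>+y. F (y - curve d s) * \<Phi> y \<partial>lborel) \<partial>param)"
    by (rule lborel_param.Fubini'[symmetric]) measurable
  also have "\<dots> = (\<integral>\<^sup>+s. (\<integral>\<^sup>+z. F z * \<Phi> (z + curve d s) \<partial>lborel) \<partial>param)"
  proof (rule nn_integral_cong)
    fix s
    show "(\<integral>\<^sup>+y. F (y - curve d s) * \<Phi> y \<partial>lborel) = (\<integral>\<^sup>+z. F z * \<Phi> (z + curve d s) \<partial>lborel)"
      by (subst nn_integral_translate[of _ "curve d s", symmetric]) (auto simp: add.commute)
  qed
  also have "\<dots> = (\<integral>\<^sup>+z. (\<integral>\<^sup>+s. F z * \<Phi> (z + curve d s) \<partial>param) \<partial>lborel)"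
    by (rule lborel_param.Fubini') measurable
  also have "\<dots> = (\<integral>\<^sup>+z. F z * (\<integral>\<^sup>+s. \<Phi> (z + curve d s) \<partial>param) \<partial>lborel)"
    by (subst nn_integral_cmult) measurable
  finally show ?thesis .
qed

text \<open>In the application \<open>r = q - 1\<close>, so \<open>\<eta> * r = q/p - 1\<close>, and
  \<open>scaling\<close> is \<open>1/p - 1/q < 1/(d + 1)\<close> multiplied by \<open>q\<close>. The
  constant is uniform in \<open>h\<close> because the bound is applied to all translates of one
  function.\<close>

lemma curve_diff_average_bound:
  fixes d :: nat and \<eta> r :: real
  assumes d: "2 \<le> d" and \<eta>: "0 < \<eta>" "\<eta> < 1/2" and r: "0 < r" "\<eta> * r < 1"
    and scaling: "\<eta> * r < (r + 1) / (real d + 1)"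
  obtains C :: real where "C > 0"
    and "\<And>h. h \<in> borel_measurable borel \<Longrightarrow> (\<And>x. 0 \<le> h x) \<Longrightarrow>
      (\<integral>\<^sup>+s. ennpowr (\<integral>\<^sup>+u. ennpowr (ennreal (h (curve d s - curve d u))) \<eta> \<partial>param) r \<partial>param)
      \<le> ennreal C * ennpowr (\<integral>\<^sup>+x. ennreal (h x) \<partial>lborel) (\<eta> * r)"
proof -
  \<comment> \<open>\<open>\<kappa>\<close> is the dual exponent of the weight in the Hoelder step
    in \<open>u\<close>, \<open>\<tau>\<close> the Hoelder exponent in \<open>s\<close>, and
    \<open>M\<close> the threshold below which \<open>s powr - m\<close> stays integrable after both
    steps.\<close>
  define \<kappa> where "\<kappa> = \<eta> / (1 - \<eta>)"
  define \<tau> where "\<tau> = \<eta> * r"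
  define M where "M = (1 - \<tau>) / ((1 - \<eta>) * r)"
  have \<kappa>: "0 < \<kappa>" "\<kappa> < 1" using \<eta> by (auto simp: \<kappa>_def field_simps)
  have \<tau>: "0 < \<tau>" "\<tau> < 1" using \<eta> r by (auto simp: \<tau>_def)
  have M: "0 < M" using \<tau> \<eta> r by (auto simp: M_def)
  \<comment> \<open>Multiplied by \<open>(1 - \<eta>) * r\<close> this reads
    \<open>(d + 1) * \<tau> < r + 1\<close>, which is \<open>scaling\<close>.\<close>
  have dM: "(real d - 1) * \<kappa> - 1 < M"
  proof -
    have "((real d - 1) * \<kappa> - 1) * ((1 - \<eta>) * r) = (real d - 1) * \<eta> * r - (1 - \<eta>) * r"
      using \<eta> by (simp add: \<kappa>_def field_simps)
    also have "\<dots> < 1 - \<tau>"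
      using scaling by (simp add: \<tau>_def field_simps)
    finally show ?thesis
      using \<eta> r by (simp add: M_def pos_less_divide_eq)
  qed
  \<comment> \<open>The integral of \<open>gap_weight d s u powr - \<kappa>\<close> in \<open>u\<close> may blow up like \<open>s powr - m\<close>: \<open>m < M\<close> is the
    integrability of the resulting power of \<open>s\<close>, and the other three conditions on \<open>m\<close> give the blow-up bound.\<close>
  obtain m where m: "0 \<le> m" "m \<le> (real d - 2) * \<kappa>" "(real d - 1) * \<kappa> - m < 1" "m < M"
  proof (cases "(real d - 1) * \<kappa> < 1")
    case True
    then show ?thesis using that[of 0] \<kappa> d M by simp
  next
    case False
    \<comment> \<open>The bound by \<open>(d - 2) * \<kappa>\<close> is \<open>\<kappa> < 1\<close>,
      that is \<open>\<eta> < 1/2\<close>.\<close>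
    have "(real d - 1) * \<kappa> - 1 < min M ((real d - 2) * \<kappa>)"
      using dM \<kappa> by (simp add: algebra_simps)
    then obtain m where "(real d - 1) * \<kappa> - 1 < m" "m < min M ((real d - 2) * \<kappa>)"
      using dense by blast
    then show ?thesis using that[of m] False by simp
  qed
  \<comment> \<open>\<open>K\<close> is the constant of the blow-up bound. The relation
    \<open>e * (1 - \<tau>) = (1 - \<eta>) * r\<close> turns the second Hoelder factor, raised to
    \<open>r\<close>, into a \<open>(1 - \<tau>)\<close>-th power. \<open>L\<close> is the integral
    of \<open>(K * s powr - m) powr e\<close> over [0,2], and \<open>2 powr \<tau>\<close> comes
    from \<open>nn_integral_curve_diff\<close>.\<close>
  define \<sigma> where "\<sigma> = (real d - 1) * \<kappa> - m"
  define K where "K = 2 * (2 powr (1 - \<sigma>) / (1 - \<sigma>))"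
  define e where "e = (1 - \<eta>) * r / (1 - \<tau>)"
  define \<nu> where "\<nu> = m * e"
  define L where "L = K powr e * (2 powr (1 - \<nu>) / (1 - \<nu>))"
  define C where "C = 2 powr \<tau> * L powr (1 - \<tau>)"
  have \<sigma>: "\<sigma> < 1" using m by (simp add: \<sigma>_def)
  have K: "K > 0" using \<sigma> by (simp add: K_def)
  have e: "e > 0" "e * (1 - \<tau>) = (1 - \<eta>) * r" using \<eta> r \<tau> by (auto simp: e_def)
  have "e = 1 / M" using \<eta> r \<tau> by (simp add: e_def M_def)
  then have \<nu>: "\<nu> < 1" using m M by (simp add: \<nu>_def)
  have L: "L > 0" using K \<nu> by (simp add: L_def)
  show ?thesis
  proof (rule that)
    show "C > 0" using L by (simp add: C_def)
    fix h :: "real \<times> real \<Rightarrow> real"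
    assume [measurable]: "h \<in> borel_measurable borel" and nn: "\<And>x. 0 \<le> h x"
    let ?N = "\<integral>\<^sup>+x. ennreal (h x) \<partial>lborel"
    define A where "A s = (\<integral>\<^sup>+u. ennreal (h (curve d s - curve d u)) * ennreal (gap_weight d s u) \<partial>param)" for s
    have [measurable]: "A \<in> borel_measurable borel" unfolding A_def by measurable
    have inner: "(\<integral>\<^sup>+u. ennpowr (ennreal (h (curve d s - curve d u))) \<eta> \<partial>param)
        \<le> ennpowr (A s) \<eta> * ennpowr (ennreal (K * s powr - m)) (1 - \<eta>)" if s: "0 < s" "s \<le> 2" for s
    proof -
      \<comment> \<open>The weight vanishes at \<open>u = s\<close>, so the splitting is asserted
        off that null point.\<close>
      have "AE u in param. ennpowr (ennreal (h (curve d s - curve d u))) \<eta>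
          = ennpowr (ennreal (h (curve d s - curve d u)) * ennreal (gap_weight d s u)) \<eta>
            * ennpowr (ennreal (gap_weight d s u powr - \<kappa>)) (1 - \<eta>)"
        unfolding AE_param using AE_lborel_singleton[of s]
      proof eventually_elim
        case (elim u)
        show ?case
        proof
          assume "u \<in> {0..2}"
          with elim s have "gap_weight d s u > 0" by (auto simp: gap_weight_def)
          then show "ennpowr (ennreal (h (curve d s - curve d u))) \<eta>
            = ennpowr (ennreal (h (curve d s - curve d u)) * ennreal (gap_weight d s u)) \<eta>
            * ennpowr (ennreal (gap_weight d s u powr - \<kappa>)) (1 - \<eta>)"
            unfolding \<kappa>_def using \<eta> by (intro ennreal_mult_powr_split) linarith+
        qed
      qed
      then have "(\<integral>\<^sup>+u. ennpowr (ennreal (h (curve d s - curve d u))) \<eta> \<partial>param)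
          = (\<integral>\<^sup>+u. ennpowr (ennreal (h (curve d s - curve d u)) * ennreal (gap_weight d s u)) \<eta>
            * ennpowr (ennreal (gap_weight d s u powr - \<kappa>)) (1 - \<eta>) \<partial>param)"
        by (rule nn_integral_cong_AE)
      also have "\<dots> \<le> ennpowr (A s) \<eta>
          * ennpowr (\<integral>\<^sup>+u. ennreal (gap_weight d s u powr - \<kappa>) \<partial>param) (1 - \<eta>)"
        unfolding A_def using \<eta> by (intro nn_integral_Holder) auto
      also have "\<dots> \<le> ennpowr (A s) \<eta> * ennpowr (ennreal (K * s powr - m)) (1 - \<eta>)"
        using nn_integral_gap_weight_powr_le[OF d s m(1,2) \<sigma>_def \<sigma>] \<eta>
        by (intro mult_left_mono ennpowr_mono) (auto simp: K_def)
      finally show ?thesis .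
    qed
    \<comment> \<open>The \<open>r\<close>-th power of \<open>inner\<close>, rearranged for Hoelder
      in \<open>s\<close>; the null point \<open>s = 0\<close> is left out because the blow-up bound
      needs \<open>s > 0\<close>.\<close>
    have AE: "AE s in param. ennpowr (\<integral>\<^sup>+u. ennpowr (ennreal (h (curve d s - curve d u))) \<eta> \<partial>param) r
        \<le> ennpowr (A s) \<tau> * ennpowr (ennreal (K powr e) * ennreal (s powr - \<nu>)) (1 - \<tau>)"
      unfolding AE_param using AE_lborel_singleton[of 0]
    proof eventually_elim
      case (elim s)
      show ?case
      proof
        assume "s \<in> {0..2}"
        with elim have s: "0 < s" "s \<le> 2" by auto
        have "ennpowr (\<integral>\<^sup>+u. ennpowr (ennreal (h (curve d s - curve d u))) \<eta> \<partial>param) r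
            \<le> ennpowr (ennpowr (A s) \<eta> * ennpowr (ennreal (K * s powr - m)) (1 - \<eta>)) r"
          using r by (intro ennpowr_mono inner s) auto
        also have "\<dots> = ennpowr (A s) \<tau> * ennpowr (ennreal (K * s powr - m)) (e * (1 - \<tau>))"
          by (simp add: ennpowr_mult ennpowr_ennpowr e flip: \<tau>_def)
        also have "ennpowr (ennreal (K * s powr - m)) (e * (1 - \<tau>))
            = ennpowr (ennreal (K powr e) * ennreal (s powr - \<nu>)) (1 - \<tau>)"
          using K by (simp add: ennpowr_ennreal powr_mult powr_powr \<nu>_def flip: ennpowr_ennpowr ennreal_mult)
        finally show "ennpowr (\<integral>\<^sup>+u. ennpowr (ennreal (h (curve d s - curve d u))) \<eta> \<partial>param) r
          \<le> ennpowr (A s) \<tau> * ennpowr (ennreal (K powr e) * ennreal (s powr - \<nu>)) (1 - \<tau>)" .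
      qed
    qed
    have "(\<integral>\<^sup>+s. ennpowr (\<integral>\<^sup>+u. ennpowr (ennreal (h (curve d s - curve d u))) \<eta> \<partial>param) r \<partial>param)
        \<le> (\<integral>\<^sup>+s. ennpowr (A s) \<tau> * ennpowr (ennreal (K powr e) * ennreal (s powr - \<nu>)) (1 - \<tau>) \<partial>param)"
      using AE by (rule nn_integral_mono_AE)
    also have "\<dots> \<le> ennpowr (\<integral>\<^sup>+s. A s \<partial>param) \<tau>
        * ennpowr (\<integral>\<^sup>+s. ennreal (K powr e) * ennreal (s powr - \<nu>) \<partial>param) (1 - \<tau>)"
      using \<tau> by (intro nn_integral_Holder) auto
    also have "(\<integral>\<^sup>+s. ennreal (K powr e) * ennreal (s powr - \<nu>) \<partial>param) = ennreal L"
    proof -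
      have "(\<integral>\<^sup>+s. ennreal (K powr e) * ennreal (s powr - \<nu>) \<partial>param)
          = ennreal (K powr e) * (\<integral>\<^sup>+s. ennreal (s powr - \<nu>) \<partial>param)"
        by (intro nn_integral_cmult) auto
      also have "(\<integral>\<^sup>+s. ennreal (s powr - \<nu>) \<partial>param) = ennreal (2 powr (1 - \<nu>) / (1 - \<nu>))"
        using nn_integral_powr_0_2[of "- \<nu>"] \<nu> by (subst nn_integral_param) auto
      finally show ?thesis using \<nu> by (simp add: L_def flip: ennreal_mult)
    qed
    also have "ennpowr (\<integral>\<^sup>+s. A s \<partial>param) \<tau> \<le> ennpowr (2 * ?N) \<tau>"
      using nn_integral_curve_diff[of h d] nn d \<tau>
      by (intro ennpowr_mono) (auto simp: A_def curve_def)
    also have "ennpowr (2 * ?N) \<tau> * ennpowr (ennreal L) (1 - \<tau>) = ennreal C * ennpowr ?N \<tau>"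
    proof -
      have "ennpowr 2 \<tau> = ennreal (2 powr \<tau>)"
        using ennpowr_ennreal[of 2 \<tau>] by simp
      then show ?thesis
        using L by (simp add: ennpowr_mult ennpowr_ennreal C_def ennreal_mult mult_ac)
    qed
    finally show "(\<integral>\<^sup>+s. ennpowr (\<integral>\<^sup>+u. ennpowr (ennreal (h (curve d s - curve d u))) \<eta> \<partial>param) r \<partial>param)
      \<le> ennreal C * ennpowr ?N (\<eta> * r)" by (simp add: \<tau>_def mult_right_mono)
  qed
qed

text \<open>Working with \<open>Q\<close>-th powers of norms postpones the root to the passage to
  the maximal function, hence the exponent \<open>Q / P\<close>.\<close>

lemma curve_avg_Lp_improving:
  fixes d :: nat and P Q :: real
  assumes d: "2 \<le> d" and PQ: "1 < P" "1 < Q" "1/Q < 1/P" "1/P < 2/Q" "2/P - 1 < 1/Q"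
      "1/P - 1/Q < 1 / (real d + 1)"
  obtains C :: real where "C > 0"
    and "\<And>f. f \<in> borel_measurable borel \<Longrightarrow> (\<And>x. 0 \<le> f x) \<Longrightarrow>
      (\<integral>\<^sup>+y. ennpowr (curve_avg d (\<lambda>x. ennreal (f x)) y) Q \<partial>lborel)
      \<le> ennreal C * ennpowr (\<integral>\<^sup>+x. ennpowr (ennreal (f x)) P \<partial>lborel) (Q / P)"
proof -
  \<comment> \<open>Chosen so that \<open>1/Q + \<eta> * (1 - 1/Q) = 1/P\<close>, which lets
    \<open>f = h powr (1/P)\<close> be factored for Hoelder with exponents \<open>1/Q\<close> and
    \<open>1 - 1/Q\<close>.\<close>
  define \<eta> where "\<eta> = (1/P - 1/Q) / (1 - 1/Q)"
  have Q': "0 < 1 - 1/Q" using PQ by simp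
  have \<eta>: "0 < \<eta>" "\<eta> < 1/2"
    using PQ Q' unfolding \<eta>_def by (simp_all add: pos_divide_less_eq)
  have \<eta>_mult: "\<eta> * (1 - 1/Q) = 1/P - 1/Q"
    unfolding \<eta>_def by (rule nonzero_eq_divide_eq[THEN iffD1]) (use Q' in auto)
  have \<eta>Q: "\<eta> * (Q - 1) = Q/P - 1"
  proof -
    have "\<eta> * (Q - 1) = Q * (\<eta> * (1 - 1/Q))" using PQ by (simp add: field_simps)
    also have "\<dots> = Q/P - 1" unfolding \<eta>_mult using PQ by (simp add: field_simps)
    finally show ?thesis .
  qed
  \<comment> \<open>This and the next bound are \<open>1/P < 2/Q\<close> and the condition with
    \<open>d + 1\<close>, each multiplied by \<open>Q\<close>.\<close>
  have "\<eta> * (Q - 1) < 1" unfolding \<eta>Q using PQ by (simp add: field_simps)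
  moreover have "\<eta> * (Q - 1) < ((Q - 1) + 1) / (real d + 1)"
  proof -
    have "Q * (1/P - 1/Q) < Q * (1 / (real d + 1))" using PQ by (intro mult_strict_left_mono) auto
    then show ?thesis unfolding \<eta>Q using PQ by (simp add: algebra_simps)
  qed
  ultimately obtain C where C: "C > 0"
    and bound: "\<And>h. h \<in> borel_measurable borel \<Longrightarrow> (\<And>x. 0 \<le> h x) \<Longrightarrow>
      (\<integral>\<^sup>+s. ennpowr (\<integral>\<^sup>+u. ennpowr (ennreal (h (curve d s - curve d u))) \<eta> \<partial>param) (Q - 1) \<partial>param)
      \<le> ennreal C * ennpowr (\<integral>\<^sup>+x. ennreal (h x) \<partial>lborel) (\<eta> * (Q - 1))"
    using curve_diff_average_bound[OF d \<eta>, of "Q - 1"] PQ by auto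
  show ?thesis
  proof (rule that[OF C])
    fix f :: "real \<times> real \<Rightarrow> real"
    assume [measurable]: "f \<in> borel_measurable borel" and nn: "\<And>x. 0 \<le> f x"
    define h where "h x = f x powr P" for x
    let ?H = "\<lambda>x. ennreal (h x)"
    let ?N = "\<integral>\<^sup>+x. ?H x \<partial>lborel"
    have [measurable]: "h \<in> borel_measurable borel" unfolding h_def by measurable
    have h: "0 \<le> h x" for x by (simp add: h_def)
    have fh: "ennreal (f x) = ennpowr (?H x) (1/Q) * ennpowr (ennpowr (?H x) \<eta>) (1 - 1/Q)" for x
    proof -
      have "ennpowr (?H x) (1/Q) * ennpowr (ennpowr (?H x) \<eta>) (1 - 1/Q) = ennpowr (?H x) (1/Q + (1/P - 1/Q))"
        by (simp only: ennpowr_add ennpowr_ennpowr \<eta>_mult)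
      also have "\<dots> = ennreal (f x)"
        using PQ nn by (simp add: h_def ennpowr_ennreal powr_powr)
      finally show ?thesis by simp
    qed
    have pt: "ennpowr (curve_avg d (\<lambda>x. ennreal (f x)) y) Q
        \<le> curve_avg d ?H y * ennpowr (curve_avg d (\<lambda>x. ennpowr (?H x) \<eta>) y) (Q - 1)" for y
    proof -
      have "curve_avg d (\<lambda>x. ennreal (f x)) y
          \<le> ennpowr (curve_avg d ?H y) (1/Q) * ennpowr (curve_avg d (\<lambda>x. ennpowr (?H x) \<eta>) y) (1 - 1/Q)"
        unfolding curve_avg_def fh using PQ by (intro nn_integral_Holder) auto
      then have "ennpowr (curve_avg d (\<lambda>x. ennreal (f x)) y) Q \<le> ennpowr
          (ennpowr (curve_avg d ?H y) (1/Q) * ennpowr (curve_avg d (\<lambda>x. ennpowr (?H x) \<eta>) y) (1 - 1/Q)) Q"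
        using PQ by (intro ennpowr_mono) auto
      also have "\<dots> = curve_avg d ?H y * ennpowr (curve_avg d (\<lambda>x. ennpowr (?H x) \<eta>) y) (Q - 1)"
        using PQ by (simp add: ennpowr_mult ennpowr_ennpowr left_diff_distrib)
      finally show ?thesis .
    qed
    have "(\<integral>\<^sup>+y. ennpowr (curve_avg d (\<lambda>x. ennreal (f x)) y) Q \<partial>lborel)
        \<le> (\<integral>\<^sup>+y. curve_avg d ?H y * ennpowr (curve_avg d (\<lambda>x. ennpowr (?H x) \<eta>) y) (Q - 1) \<partial>lborel)"
      by (intro nn_integral_mono pt)
    also have "\<dots> = (\<integral>\<^sup>+z. ?H z * (\<integral>\<^sup>+s. ennpowr (curve_avg d (\<lambda>x. ennpowr (?H x) \<eta>) (z + curve d s)) (Q - 1) \<partial>param) \<partial>lborel)"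
      by (rule nn_integral_curve_avg_mult) measurable
    \<comment> \<open>The inner integral is bounded uniformly in \<open>z\<close>:
      \<open>bound\<close> is applied to the translate of \<open>h\<close> by \<open>z\<close>,
      which has the same total integral \<open>?N\<close>.\<close>
    also have "\<dots> \<le> (\<integral>\<^sup>+z. ?H z * (ennreal C * ennpowr ?N (\<eta> * (Q - 1))) \<partial>lborel)"
    proof (intro nn_integral_mono mult_left_mono)
      fix z
      have "(\<integral>\<^sup>+s. ennpowr (curve_avg d (\<lambda>x. ennpowr (?H x) \<eta>) (z + curve d s)) (Q - 1) \<partial>param)
          \<le> ennreal C * ennpowr (\<integral>\<^sup>+x. ?H (z + x) \<partial>lborel) (\<eta> * (Q - 1))"
        using bound[of "\<lambda>x. h (z + x)"] h by (simp add: curve_avg_def add_diff_eq)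
      then show "(\<integral>\<^sup>+s. ennpowr (curve_avg d (\<lambda>x. ennpowr (?H x) \<eta>) (z + curve d s)) (Q - 1) \<partial>param)
          \<le> ennreal C * ennpowr ?N (\<eta> * (Q - 1))"
        by (simp add: nn_integral_translate[of ?H])
    qed auto
    also have "\<dots> = ?N * (ennreal C * ennpowr ?N (\<eta> * (Q - 1)))"
      by (rule nn_integral_multc) measurable
    also have "\<dots> = ennreal C * ennpowr ?N (1 + \<eta> * (Q - 1))"
      by (simp add: ennpowr_add mult_ac)
    also have "\<dots> = ennreal C * ennpowr (\<integral>\<^sup>+x. ennpowr (ennreal (f x)) P \<partial>lborel) (Q / P)"
      using nn by (simp add: \<eta>Q h_def ennpowr_ennreal)
    finally show "(\<integral>\<^sup>+y. ennpowr (curve_avg d (\<lambda>x. ennreal (f x)) y) Q \<partial>lborel)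
      \<le> ennreal C * ennpowr (\<integral>\<^sup>+x. ennpowr (ennreal (f x)) P \<partial>lborel) (Q / P)" .
  qed
qed

text \<open>Hoelder against the constant 1 on a space of mass 2 costs \<open>2 powr (P - 1)\<close>,
  and the adjoint average of a constant costs another factor 2. \<open>P = 1\<close> is separate
  because Hoelder needs \<open>1/P < 1\<close>.\<close>

lemma curve_avg_Lp_Lp:
  assumes P: "1 \<le> P" and [measurable]: "F \<in> borel_measurable borel"
  shows "(\<integral>\<^sup>+y. ennpowr (curve_avg d F y) P \<partial>lborel)
      \<le> ennreal (2 powr P) * (\<integral>\<^sup>+x. ennpowr (F x) P \<partial>lborel)"
proof -
  have mass: "(\<integral>\<^sup>+u. 1 \<partial>param) = 2"
    by (subst nn_integral_param) auto
  have two: "ennpowr 2 a = ennreal (2 powr a)" for a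
    using ennpowr_ennreal[of 2 a] by simp
  have pt: "ennpowr (curve_avg d F y) P \<le> curve_avg d (\<lambda>x. ennpowr (F x) P) y * ennreal (2 powr (P - 1))" for y
  proof (cases "P = 1")
    case True
    then show ?thesis by simp
  next
    case False
    then have P1: "1 < P" using P by simp
    have "curve_avg d F y = (\<integral>\<^sup>+u. ennpowr (ennpowr (F (y - curve d u)) P) (1/P) * ennpowr 1 (1 - 1/P) \<partial>param)"
      using P1 ennpowr_ennreal[of 1] by (simp add: ennpowr_ennpowr curve_avg_def)
    also have "\<dots> \<le> ennpowr (curve_avg d (\<lambda>x. ennpowr (F x) P) y) (1/P) * ennpowr (\<integral>\<^sup>+u. 1 \<partial>param) (1 - 1/P)"
      unfolding curve_avg_def using P1 by (intro nn_integral_Holder) auto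
    finally have "ennpowr (curve_avg d F y) P \<le> ennpowr
        (ennpowr (curve_avg d (\<lambda>x. ennpowr (F x) P) y) (1/P) * ennpowr 2 (1 - 1/P)) P"
      unfolding mass using P by (intro ennpowr_mono) auto
    also have "\<dots> = curve_avg d (\<lambda>x. ennpowr (F x) P) y * ennreal (2 powr (P - 1))"
      using P1 by (simp add: ennpowr_mult ennpowr_ennpowr left_diff_distrib flip: two)
    finally show ?thesis .
  qed
  have "(\<integral>\<^sup>+y. ennpowr (curve_avg d F y) P \<partial>lborel)
      \<le> (\<integral>\<^sup>+y. curve_avg d (\<lambda>x. ennpowr (F x) P) y * ennreal (2 powr (P - 1)) \<partial>lborel)"
    by (intro nn_integral_mono pt)
  also have "\<dots> = (\<integral>\<^sup>+z. ennpowr (F z) P * (\<integral>\<^sup>+s. ennreal (2 powr (P - 1)) * 1 \<partial>param) \<partial>lborel)"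
    using nn_integral_curve_avg_mult[of "\<lambda>x. ennpowr (F x) P" "\<lambda>_. ennreal (2 powr (P - 1))"] by simp
  also have "(\<integral>\<^sup>+s. ennreal (2 powr (P - 1)) * 1 \<partial>param) = ennreal (2 powr (P - 1)) * 2"
    by (subst nn_integral_cmult) (simp_all only: mass, simp)
  also have "\<dots> = ennreal (2 powr (P - 1) * 2)"
    by (simp add: ennreal_mult)
  also have "2 powr (P - 1) * 2 = 2 powr P"
    by (simp add: powr_diff)
  also have "(\<integral>\<^sup>+z. ennpowr (F z) P * ennreal (2 powr P) \<partial>lborel) = ennreal (2 powr P) * (\<integral>\<^sup>+x. ennpowr (F x) P \<partial>lborel)"
    by (subst nn_integral_multc) (auto simp: mult.commute)
  finally show ?thesis .
qed

section \<open>The maximal function\<close>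

lemma continuous_on_test_function:
  assumes "test_function f"
  shows "continuous_on UNIV f"
  using assms unfolding test_function_def by (metis C_k.simps(1))

lemma avg_eq_curve: "avg d t f y = (LINT x:{0..1}|lborel. f (y - curve d (t * x)))"
  by (cases y) (simp add: avg_def curve_def power_mult_distrib)

text \<open>Holds without any hypothesis on \<open>f\<close>: where integrability fails, the Bochner
  integral is 0 by convention.\<close>

lemma norm_avg_le:
  "ennreal (norm (avg d t f y))
    \<le> (\<integral>\<^sup>+x. ennreal (norm (f (y - curve d (t * x)))) * indicator {0..1} x \<partial>lborel)"
proof (cases "set_integrable lborel {0..1} (\<lambda>x. f (y - curve d (t * x)))")
  case True
  then have "ennreal (norm (avg d t f y))
      \<le> (\<integral>\<^sup>+x. ennreal (norm (indicator {0..1} x *\<^sub>R f (y - curve d (t * x)))) \<partial>lborel)"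
    unfolding avg_eq_curve set_lebesgue_integral_def set_integrable_def
    by (rule integral_norm_bound_ennreal)
  also have "\<dots> = (\<integral>\<^sup>+x. ennreal (norm (f (y - curve d (t * x)))) * indicator {0..1} x \<partial>lborel)"
    by (intro nn_integral_cong) (auto split: split_indicator)
  finally show ?thesis .
next
  case False
  then have "avg d t f y = 0"
    unfolding avg_eq_curve set_lebesgue_integral_def set_integrable_def
    by (rule not_integrable_integral_eq)
  then show ?thesis by simp
qed

lemma maximal_avg_le_curve_avg:
  assumes [measurable]: "f \<in> borel_measurable borel"
  shows "maximal_avg d f y \<le> curve_avg d (\<lambda>x. ennreal (norm (f x))) y"
  unfolding maximal_avg_def
proof (rule SUP_least)
  fix t :: real
  assume t: "t \<in> {1..2}"
  let ?G = "\<lambda>u. ennreal (norm (f (y - curve d u))) * indicator {0..2} u"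
  have "ennreal (norm (avg d t f y))
      \<le> (\<integral>\<^sup>+x. ennreal (norm (f (y - curve d (t * x)))) * indicator {0..1} x \<partial>lborel)"
    by (rule norm_avg_le)
  also have "\<dots> \<le> (\<integral>\<^sup>+x. ?G (0 + t * x) \<partial>lborel)"
  proof (rule nn_integral_mono)
    fix x :: real
    have "0 \<le> t * x \<and> t * x \<le> 2" if "0 \<le> x" "x \<le> 1"
      using that t mult_mono[of t 2 x 1] by auto
    then show "ennreal (norm (f (y - curve d (t * x)))) * indicator {0..1} x \<le> ?G (0 + t * x)"
      by (auto split: split_indicator)
  qed
  \<comment> \<open>The Jacobian of \<open>u = t * x\<close> is \<open>t \<ge> 1\<close>, so
    inserting it only enlarges the bound.\<close>
  also have "\<dots> \<le> ennreal \<bar>t\<bar> * (\<integral>\<^sup>+x. ?G (0 + t * x) \<partial>lborel)"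
    using t mult_right_mono[of 1 "ennreal t" "\<integral>\<^sup>+x. ?G (0 + t * x) \<partial>lborel"] by simp
  also have "\<dots> = (\<integral>\<^sup>+u. ?G u \<partial>lborel)"
    using t by (intro nn_integral_real_affine[symmetric]) auto
  also have "\<dots> = curve_avg d (\<lambda>x. ennreal (norm (f x))) y"
    unfolding curve_avg_def by (subst nn_integral_param) auto
  finally show "ennreal (norm (avg d t f y)) \<le> curve_avg d (\<lambda>x. ennreal (norm (f x))) y" .
qed

lemma continuous_on_avg:
  assumes f: "continuous_on UNIV f"
  shows "continuous_on UNIV (avg d t f)"
proof -
  have cont: "continuous_on S (\<lambda>x. f (g x))" if "continuous_on S g" for S and g :: "'a::topological_space \<Rightarrow> real \<times> real"
    using continuous_on_compose2[OF f that] by simp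
  have "avg d t f = (\<lambda>y. integral (cbox 0 1) (\<lambda>x. f (y - curve d (t * x))))"
  proof
    fix y
    have "set_integrable lborel {0..1} (\<lambda>x. f (y - curve d (t * x)))"
      by (intro borel_integrable_atLeastAtMost' cont) (auto simp: curve_def intro!: continuous_intros)
    then show "avg d t f y = integral (cbox 0 1) (\<lambda>x. f (y - curve d (t * x)))"
      unfolding avg_eq_curve by (simp add: set_borel_integral_eq_integral)
  qed
  moreover have "continuous_on UNIV (\<lambda>y. integral (cbox 0 1) (\<lambda>x. f (y - curve d (t * x))))"
    by (intro integral_continuous_on_param)
      (auto simp: split_beta curve_def intro!: cont continuous_intros)
  ultimately show ?thesis by simp
qed

text \<open>The supremum is over uncountably many \<open>t\<close>, but each average is continuous,
  so the superlevel sets are unions of open sets. The essential supremum at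
  \<open>q = \<infinity>\<close> uses this.\<close>

lemma borel_measurable_maximal_avg:
  assumes f: "continuous_on UNIV f"
  shows "maximal_avg d f \<in> borel_measurable borel"
proof (rule borel_measurableI_greater)
  fix a
  have "open {y. a < ennreal (norm (avg d t f y))}" for t
    by (intro open_Collect_less continuous_intros continuous_on_ennreal continuous_on_avg f)
  then have "open (\<Union>t\<in>{1..2}. {y. a < ennreal (norm (avg d t f y))})"
    by blast
  moreover have "{y \<in> space borel. a < maximal_avg d f y} = (\<Union>t\<in>{1..2}. {y. a < ennreal (norm (avg d t f y))})"
    by (auto simp: maximal_avg_def less_SUP_iff)
  ultimately show "{y \<in> space borel. a < maximal_avg d f y} \<in> sets borel"
    by simp
qed

section \<open>Norm bounds for the maximal function\<close>

lemma maximal_bound_infinity: "maximal_bound d \<infinity> \<infinity> 1"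
  unfolding maximal_bound_def
proof (intro allI impI)
  fix f :: "real \<times> real \<Rightarrow> complex"
  assume "test_function f"
  then have f: "continuous_on UNIV f" by (rule continuous_on_test_function)
  define E where "E = esssup lborel (\<lambda>y. ennreal (norm (f y)))"
  \<comment> \<open>The averages see \<open>f\<close> only on null curves, so an almost everywhere
    bound is not enough; by continuity it holds everywhere.\<close>
  have "closed {x. ennreal (norm (f x)) \<le> E}"
    by (intro closed_Collect_le continuous_intros continuous_on_ennreal f)
  moreover have "AE x in lborel. ennreal (norm (f x)) \<le> E"
    unfolding E_def by (rule esssup_AE)
  ultimately have le: "ennreal (norm (f x)) \<le> E" for x
    using mem_closed_if_AE_lebesgue[of "{x. ennreal (norm (f x)) \<le> E}" x] AE_completion by auto
  have "maximal_avg d f y \<le> E" for y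
    unfolding maximal_avg_def
  proof (rule SUP_least)
    fix t
    have "ennreal (norm (avg d t f y))
        \<le> (\<integral>\<^sup>+x. ennreal (norm (f (y - curve d (t * x)))) * indicator {0..1} x \<partial>lborel)"
      by (rule norm_avg_le)
    also have "\<dots> \<le> (\<integral>\<^sup>+x. E * indicator {0..1::real} x \<partial>lborel)"
      by (intro nn_integral_mono mult_right_mono le) auto
    also have "\<dots> = E" by (simp add: nn_integral_cmult)
    finally show "ennreal (norm (avg d t f y)) \<le> E" .
  qed
  then have "esssup lborel (maximal_avg d f) \<le> E"
    using borel_measurable_maximal_avg[OF f] by (intro esssup_I) auto
  then show "Lp_norm \<infinity> (maximal_avg d f) \<le> ennreal 1 * Lp_norm \<infinity> (\<lambda>y. ennreal (norm (f y)))"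
    by (simp add: Lp_norm_def E_def)
qed

text \<open>Pointwise domination followed by a \<open>Q\<close>-th root, which turns the exponent
  \<open>Q / P\<close> into \<open>1 / P\<close>. It serves both the diagonal and the improving
  range.\<close>

lemma maximal_bound_if_curve_avg_bound:
  assumes PQ: "1 \<le> P" "1 \<le> Q" and C: "C > 0"
    and bound: "\<And>f. f \<in> borel_measurable borel \<Longrightarrow> (\<And>x. 0 \<le> f x) \<Longrightarrow>
      (\<integral>\<^sup>+y. ennpowr (curve_avg d (\<lambda>x. ennreal (f x)) y) Q \<partial>lborel)
      \<le> ennreal C * ennpowr (\<integral>\<^sup>+x. ennpowr (ennreal (f x)) P \<partial>lborel) (Q / P)"
  shows "maximal_bound d (ennreal P) (ennreal Q) (C powr (1/Q))"
  unfolding maximal_bound_def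
proof (intro allI impI)
  fix f :: "real \<times> real \<Rightarrow> complex"
  assume "test_function f"
  then have [measurable]: "f \<in> borel_measurable borel"
    by (intro borel_measurable_continuous_onI continuous_on_test_function)
  let ?N = "\<integral>\<^sup>+x. ennpowr (ennreal (norm (f x))) P \<partial>lborel"
  have "(\<integral>\<^sup>+y. ennpowr (maximal_avg d f y) Q \<partial>lborel)
      \<le> (\<integral>\<^sup>+y. ennpowr (curve_avg d (\<lambda>x. ennreal (norm (f x))) y) Q \<partial>lborel)"
    using PQ by (intro nn_integral_mono ennpowr_mono maximal_avg_le_curve_avg) auto
  also have "\<dots> \<le> ennreal C * ennpowr ?N (Q / P)"
    by (rule bound) auto
  finally have "ennpowr (\<integral>\<^sup>+y. ennpowr (maximal_avg d f y) Q \<partial>lborel) (1/Q)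
      \<le> ennpowr (ennreal C * ennpowr ?N (Q / P)) (1/Q)"
    using PQ by (intro ennpowr_mono) auto
  also have "\<dots> = ennreal (C powr (1/Q)) * ennpowr ?N (1/P)"
    using PQ C by (simp add: ennpowr_mult ennpowr_ennpowr ennpowr_ennreal)
  finally show "Lp_norm (ennreal Q) (maximal_avg d f)
      \<le> ennreal (C powr (1/Q)) * Lp_norm (ennreal P) (\<lambda>y. ennreal (norm (f y)))"
    using PQ by (simp add: Lp_norm_def)
qed

theorem theorem1p7:
  fixes d :: nat and p q :: ennreal
  assumes "2 \<le> d"
    and "1 \<le> p" and "1 \<le> q"
    and "(enn2real (1 / p), enn2real (1 / q)) \<in> Delta3 d"
  shows "\<exists>C>0. maximal_bound d p q C"
proof -
  have finite: "\<exists>R\<ge>1. r = ennreal R \<and> enn2real (1 / r) = 1 / R" if "1 \<le> r" "r \<noteq> \<infinity>" for r :: ennreal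
  proof -
    obtain R where R: "0 \<le> R" "r = ennreal R" using \<open>r \<noteq> \<infinity>\<close> by (cases r) auto
    then have "1 \<le> R" using \<open>1 \<le> r\<close> by (metis ennreal_1 ennreal_le_iff)
    moreover have "1 / r = ennreal (1 / R)"
      using R \<open>1 \<le> R\<close> divide_ennreal[of 1 R] by simp
    ultimately show ?thesis using R by auto
  qed
  show ?thesis
  proof (cases "p = \<infinity> \<or> q = \<infinity>")
    case True
    \<comment> \<open>An infinite exponent is a zero coordinate, and
      \<open>a / 2 < b \<le> a\<close> excludes exactly one zero coordinate.\<close>
    have "p = \<infinity> \<and> q = \<infinity>"
    proof (rule ccontr)
      assume "\<not> ?thesis"
      with True consider "p = \<infinity>" "q \<noteq> \<infinity>" | "p \<noteq> \<infinity>" "q = \<infinity>" by auto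
      then show False
      proof cases
        case 1
        then obtain Q where "1 \<le> Q" "enn2real (1 / q) = 1 / Q" using finite assms(3) by blast
        then show False using assms(4) 1 by (auto simp: Delta3_def)
      next
        case 2
        then obtain P where "1 \<le> P" "enn2real (1 / p) = 1 / P" using finite assms(2) by blast
        then show False using assms(4) 2 by (auto simp: Delta3_def)
      qed
    qed
    then show ?thesis using maximal_bound_infinity[of d] zero_less_one by blast
  next
    case False
    then obtain P Q where P: "1 \<le> P" "p = ennreal P" "enn2real (1 / p) = 1 / P"
      and Q: "1 \<le> Q" "q = ennreal Q" "enn2real (1 / q) = 1 / Q"
      using finite assms(2,3) by meson
    show ?thesis
    \<comment> \<open>On the diagonal, which contains the vertex (1,1), \<open>\<eta>\<close> would
      be 0, and the factorisation behind the improving bound degenerates.\<close>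
    proof (cases "P = Q")
      case True
      then have "maximal_bound d p q ((2 powr P) powr (1/Q))"
        unfolding P Q using P(1) Q(1) curve_avg_Lp_Lp[OF P(1)]
        by (intro maximal_bound_if_curve_avg_bound) auto
      then show ?thesis by (intro exI[of _ "(2 powr P) powr (1/Q)"]) auto
    next
      case False
      then have reg: "1/P < 2/Q" "1/Q < 1/P" "2/P - 1 < 1/Q" "1/P - 1/Q < 1 / (real d + 1)"
        using assms(4) P(1) Q(1) unfolding P(3) Q(3) by (auto simp: Delta3_def order_le_less)
      \<comment> \<open>From \<open>2/P - 1 < 1/Q < 1/P\<close>.\<close>
      then have "1/P < 1" by linarith
      with reg have "1/Q < 1" by linarith
      have "1 < P" "1 < Q" using \<open>1/P < 1\<close> \<open>1/Q < 1\<close> P(1) Q(1) by auto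
      then obtain C where "C > 0"
        and "\<And>f. f \<in> borel_measurable borel \<Longrightarrow> (\<And>x. 0 \<le> f x) \<Longrightarrow>
          (\<integral>\<^sup>+y. ennpowr (curve_avg d (\<lambda>x. ennreal (f x)) y) Q \<partial>lborel)
          \<le> ennreal C * ennpowr (\<integral>\<^sup>+x. ennpowr (ennreal (f x)) P \<partial>lborel) (Q / P)"
        using curve_avg_Lp_improving[OF assms(1) _ _ reg(2,1,3,4)] by blast
      then have "maximal_bound d p q (C powr (1/Q))"
        unfolding P Q using P(1) Q(1) by (intro maximal_bound_if_curve_avg_bound) auto
      then show ?thesis using \<open>C > 0\<close> by (intro exI[of _ "C powr (1/Q)"]) auto
    qed
  qed
qed

end
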